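(* Let $S_{p,\gamma,\zeta}(s)$ be a self-similar hierarchical branching process with $0<p<1$, $\gamma>0$ and Tokunaga coefficients $\{T_k\}_{k\ge1}$. Suppose that $L:=\limsup_{k\to\infty}T_k^{1/k}<\infty$ and $\zeta\ge\max(1,L)$. Then the following conditions are equivalent: (i) the process is critical; (ii) the process is time-invariant; (iii) the following relations hold: $\zeta<R$ and $p=p_c:=1-\dfrac{\zeta}{R}$.
   Context: Hierarchical branching process. Given a sequence $\{T_k\}_{k\ge1}$ of nonnegative numbers (Tokunaga coefficients), a sequence $\{\lambda_j\}_{j\ge1}$ of positive numbers and a probability mass function $\{p_K\}_{K\ge1}$, $S=(\{T_k\},\{\lambda_j\},\{p_K\})$ is the multi-type continuous-time branching process that starts with a single root branch of order $K$ with probability $p_K$. Independently of the other branches, every branch of order $j$ produces offspring branches of each order $i<j$ with rate $\lambda_jT_{j-i}$, and terminates with rate $\lambda_j$. After termination, a branch of order $j\ge2$ splits into two branches of order $j-1$; a branch of order 1 terminates without leaving offspring. The self-similar process $S_{p,\gamma,\zeta}$ is the one with $p_K=p(1-p)^{K-1}$, $K\ge1$, and $\lambda_j=\gamma\zeta^{-j}$, $j\ge1$. Let $\pi=\sum_{K\ge1}p_Ke_K$, $\Lambda=\mathrm{diag}\{\lambda_1,\lambda_2,\dots\}$ and let $\mathbb{G}$ be the upper triangular Toeplitz operator with $\mathbb{G}_{i,i}=-1$, $\mathbb{G}_{i,i+1}=T_1+2$, $\mathbb{G}_{i,i+k}=T_k$ for $k\ge2$, $\mathbb{G}_{i,j}=0$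 for $j<i$. The vector $x(s)$ of the expected numbers $x_j(s)$ of branches of order $j\geq 1$ alive at instant $s$ satisfies $\dot x=\mathbb{G}\Lambda x$, $x(0)=\pi$. The width function is $C(s)=\sum_{j\ge1}x_j(s)=\|e^{\mathbb{G}\Lambda s}\pi\|_1$. The process is critical if $C(s)=1$ for all $s\ge0$. The process is time-invariant if $e^{\mathbb{G}\Lambda s}\pi=\pi$ for all $s\ge0$. Horton exponent. Let $\hat t(z)=-1+2z+\sum_{j\ge1}z^jT_j$ for $|z|<1/L$. $w_0$ denotes the unique real root of $\hat t$ within $(0,\tfrac12]$, and $R:=w_0^{-1}$. *)

theory Defs
  imports "HOL-Analysis.Analysis"
begin

text \<open>
  Orders of branches are the natural numbers \<open>j \<ge> 1\<close>. Vectors and infinite matrices indexed by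
  orders are functions on \<^typ>\<open>nat\<close>; their values at index \<open>0\<close> are irrelevant and never enter a sum.
\<close>

record hbp =
  tokunaga :: "nat \<Rightarrow> real"
  rate :: "nat \<Rightarrow> real"
  root_pmf :: "nat \<Rightarrow> real"

definition hierarchical_branching_process :: "hbp \<Rightarrow> bool" where
  "hierarchical_branching_process S \<longleftrightarrow>
     (\<forall>k\<ge>1. tokunaga S k \<ge> 0) \<and> (\<forall>j\<ge>1. rate S j > 0) \<and>
     (\<forall>K\<ge>1. root_pmf S K \<ge> 0) \<and> (root_pmf S has_sum 1) {1..}"

definition self_similar_hbp :: "(nat \<Rightarrow> real) \<Rightarrow> real \<Rightarrow> real \<Rightarrow> real \<Rightarrow> hbp" where
  "self_similar_hbp T p \<gamma> \<zeta> =
     \<lparr>tokunaga = T, rate = (\<lambda>j. \<gamma> / \<zeta> ^ j), root_pmf = (\<lambda>K. p * (1 - p) ^ (K - 1))\<rparr>"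

definition G_matrix :: "(nat \<Rightarrow> real) \<Rightarrow> nat \<Rightarrow> nat \<Rightarrow> real" where
  "G_matrix T i j =
     (if j < i then 0 else if j = i then -1 else if j = i + 1 then T 1 + 2 else T (j - i))"

definition matrix_apply :: "(nat \<Rightarrow> nat \<Rightarrow> real) \<Rightarrow> (nat \<Rightarrow> real) \<Rightarrow> nat \<Rightarrow> real" where
  "matrix_apply A v i = (\<Sum>\<^sub>\<infinity>j\<in>{1..}. A i j * v j)"

definition diag_apply :: "(nat \<Rightarrow> real) \<Rightarrow> (nat \<Rightarrow> real) \<Rightarrow> nat \<Rightarrow> real" where
  "diag_apply d v j = d j * v j"

definition generator :: "hbp \<Rightarrow> (nat \<Rightarrow> real) \<Rightarrow> nat \<Rightarrow> real" where
  "generator S = matrix_apply (G_matrix (tokunaga S)) \<circ> diag_apply (rate S)"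

text \<open>
  The power series of \<open>e\<^bsup>sA\<^esup>v\<close>, entry by entry. The operator \<open>\<G>\<Lambda>\<close> need not be bounded on
  summable sequences; the lemmas at the end show that for a self-similar process with
  \<open>\<zeta> \<ge> max 1 L\<close> all sums that occur converge absolutely.
\<close>
definition exp_apply ::
    "((nat \<Rightarrow> real) \<Rightarrow> nat \<Rightarrow> real) \<Rightarrow> real \<Rightarrow> (nat \<Rightarrow> real) \<Rightarrow> nat \<Rightarrow> real" where
  "exp_apply A s v i = (\<Sum>n. s ^ n / fact n * (A ^^ n) v i)"

text \<open>
  The expected number of branches of order \<open>j\<close> alive at time \<open>s\<close>, as the solution
  \<open>e\<^bsup>\<G>\<Lambda>s\<^esup>\<pi>\<close> of its evolution equation.
\<close>
definition mean_branches :: "hbp \<Rightarrow> real \<Rightarrow> nat \<Rightarrow> real" where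
  "mean_branches S s = exp_apply (generator S) s (root_pmf S)"

definition width :: "hbp \<Rightarrow> real \<Rightarrow> real" where
  "width S s = (\<Sum>\<^sub>\<infinity>j\<in>{1..}. mean_branches S s j)"

definition critical :: "hbp \<Rightarrow> bool" where
  "critical S \<longleftrightarrow> (\<forall>s\<ge>0. width S s = 1)"

definition time_invariant :: "hbp \<Rightarrow> bool" where
  "time_invariant S \<longleftrightarrow> (\<forall>s\<ge>0. \<forall>j\<ge>1. mean_branches S s j = root_pmf S j)"

definition tokunaga_growth :: "(nat \<Rightarrow> real) \<Rightarrow> ereal" where
  "tokunaga_growth T = limsup (\<lambda>k. ereal (root k (T k)))"

definition t_hat :: "(nat \<Rightarrow> real) \<Rightarrow> real \<Rightarrow> real" where
  "t_hat T z = -1 + 2 * z + (\<Sum>\<^sub>\<infinity>j\<in>{1..}. z ^ j * T j)"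

text \<open>The domain of \<open>t_hat\<close> is \<open>\<bar>z\<bar> < 1 / L\<close>, where \<open>1 / 0 = \<infinity>\<close>.\<close>
definition horton_root :: "(nat \<Rightarrow> real) \<Rightarrow> real \<Rightarrow> bool" where
  "horton_root T w \<longleftrightarrow>
     0 < w \<and> w \<le> 1 / 2 \<and> ereal \<bar>w\<bar> < 1 / tokunaga_growth T \<and> t_hat T w = 0"

text \<open>
  There is never more than one such root. If \<open>L \<ge> 2\<close> it may fail to exist inside the disc of
  convergence; an example is \<open>T\<^sub>k = 3\<^sup>k / (100 k\<^sup>2)\<close>. The Horton exponent is then undefined, and the
  value \<open>0\<close> makes every relation \<open>\<zeta> < R\<close> with \<open>\<zeta> \<ge> 1\<close> false.
\<close>
definition horton_exponent :: "(nat \<Rightarrow> real) \<Rightarrow> real" where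
  "horton_exponent T =
     (if \<exists>!w. horton_root T w then inverse (THE w. horton_root T w) else 0)"

context
  fixes T :: "nat \<Rightarrow> real" and p \<gamma> \<zeta> :: real
  assumes T_nonneg: "\<And>k. k \<ge> 1 \<Longrightarrow> T k \<ge> 0"
    and p_pos: "0 < p" and p_less: "p < 1" and gamma_pos: "\<gamma> > 0"
    and growth: "tokunaga_growth T < \<infinity>"
    and zeta: "ereal \<zeta> \<ge> max 1 (tokunaga_growth T)"
begin

lemma zeta_ge_1: "\<zeta> \<ge> 1"
  using zeta by simp

lemma hierarchical_branching_process_self_similar:
  "hierarchical_branching_process (self_similar_hbp T p \<gamma> \<zeta>)"
proof -
  have "(\<lambda>n. p * (1 - p) ^ n) sums (p * (1 / (1 - (1 - p))))"
    using p_pos p_less by (intro sums_mult geometric_sums) auto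
  then have "((\<lambda>n. p * (1 - p) ^ n) has_sum 1) UNIV"
    using p_pos p_less by (intro sums_nonneg_imp_has_sum) auto
  moreover have "{1..} = range Suc"
    by (auto simp: image_iff Suc_le_eq gr0_conv_Suc)
  ultimately have "((\<lambda>K. p * (1 - p) ^ (K - 1)) has_sum 1) {1..}"
    by (simp add: has_sum_reindex o_def)
  then show ?thesis
    using T_nonneg p_pos p_less gamma_pos zeta_ge_1
    by (simp add: hierarchical_branching_process_def self_similar_hbp_def)
qed

lemma tokunaga_series_summable:
  assumes "0 < w" "w < 1 / \<zeta>"
  shows "(\<lambda>j. w ^ j * T j) summable_on {1..}"
proof -
  have growth_eq: "limsup (\<lambda>k. ereal (root k (norm (T k)))) = tokunaga_growth T"
    unfolding tokunaga_growth_def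
    by (rule Limsup_eq, rule eventually_sequentiallyI[of 1]) (simp add: T_nonneg)
  have nonneg: "0 \<le> tokunaga_growth T"
  proof -
    have "0 = limsup (\<lambda>n::nat. 0::ereal)"
      by (simp add: Limsup_const)
    also have "\<dots> \<le> limsup (\<lambda>k. ereal (root k (norm (T k))))"
      by (intro Limsup_mono) (simp_all add: real_root_ge_zero)
    finally show ?thesis
      unfolding growth_eq .
  qed
  have "ereal (1 / \<zeta>) = inverse (ereal \<zeta>)"
    using zeta_ge_1 by (simp add: inverse_eq_divide)
  also have "\<dots> \<le> inverse (tokunaga_growth T)"
    using zeta nonneg by (intro ereal_inverse_antimono) auto
  also have "\<dots> = conv_radius T"
    unfolding conv_radius_def growth_eq by (rule refl)
  finally have "ereal (1 / \<zeta>) \<le> conv_radius T" .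
  moreover have "ereal (norm w) < ereal (1 / \<zeta>)"
    using assms by simp
  ultimately have "ereal (norm w) < conv_radius T"
    by (rule less_le_trans[rotated])
  from abs_summable_in_conv_radius[OF this]
  have "(\<lambda>j. T j * w ^ j) summable_on UNIV"
    by (rule norm_summable_imp_summable_on)
  then show ?thesis
    unfolding mult.commute[of _ "T _"] by (rule summable_on_subset_banach) auto
qed

lemma G_row_has_sum:
  assumes "0 < w" "w < 1 / \<zeta>" "i \<ge> 1"
  shows "((\<lambda>j. G_matrix T i j * w ^ j) has_sum (t_hat T w * w ^ i)) {1..}"
proof -
  define f where "f k = (if k = 0 then -1 else if k = 1 then 2 * w else 0) +
    (if k = 0 then 0 else w ^ k * T k)" for k
  have "((\<lambda>k::nat. if k = 0 then -1 else if k = 1 then 2 * w else 0) has_sum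
          (\<Sum>k\<in>{0,1::nat}. if k = 0 then -1 else if k = 1 then 2 * w else 0)) UNIV"
    by (rule has_sum_finite_neutralI[where B = "{0, 1::nat}"]) auto
  moreover have "((\<lambda>j. w ^ j * T j) has_sum (\<Sum>\<^sub>\<infinity>j\<in>{1..}. w ^ j * T j)) {1..}"
    using tokunaga_series_summable[OF assms(1,2)] by (rule has_sum_infsum)
  then have "((\<lambda>k. if k = 0 then 0 else w ^ k * T k) has_sum (\<Sum>\<^sub>\<infinity>j\<in>{1..}. w ^ j * T j)) UNIV"
    by (rule has_sum_cong_neutral[THEN iffD1, rotated -1]) auto
  ultimately have "(f has_sum t_hat T w) UNIV"
    unfolding f_def t_hat_def by (auto dest: has_sum_add)
  then have "((\<lambda>k. f k * w ^ i) has_sum (t_hat T w * w ^ i)) UNIV"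
    by (rule has_sum_cmult_left)
  moreover have "f k * w ^ i = G_matrix T i (i + k) * w ^ (i + k)" for k
    by (auto simp: f_def G_matrix_def power_add algebra_simps)
  moreover have "range (\<lambda>k. i + k) = {i..}"
    by (auto simp: image_iff le_iff_add)
  ultimately have "((\<lambda>j. G_matrix T i j * w ^ j) has_sum (t_hat T w * w ^ i)) {i..}"
    using has_sum_reindex[of "\<lambda>k. i + k" UNIV "\<lambda>j. G_matrix T i j * w ^ j"] by (simp add: o_def)
  then show ?thesis
    by (rule has_sum_cong_neutral[THEN iffD1, rotated -1])
       (use assms(3) in \<open>auto simp: G_matrix_def\<close>)
qed

definition iterate_ratio :: "nat \<Rightarrow> real" where
  "iterate_ratio n = (1 - p) / \<zeta> ^ n"

primrec iterate_coeff :: "nat \<Rightarrow> real" where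
  "iterate_coeff 0 = p / (1 - p)"
| "iterate_coeff (Suc n) = \<gamma> * t_hat T (iterate_ratio (Suc n)) * iterate_coeff n"

lemma iterate_ratio_bounds:
  "0 < iterate_ratio n" "iterate_ratio n \<le> 1 - p"
  "iterate_ratio (Suc n) \<le> iterate_ratio 1" "iterate_ratio (Suc n) < 1 / \<zeta>"
proof -
  have z: "\<zeta> \<ge> 1" "\<zeta> ^ n \<ge> 1"
    using zeta_ge_1 by auto
  show "0 < iterate_ratio n" "iterate_ratio n \<le> 1 - p"
    using z p_less by (simp_all add: iterate_ratio_def divide_le_eq)
  show le: "iterate_ratio (Suc n) \<le> iterate_ratio 1"
    using z p_less zeta_ge_1 by (simp add: iterate_ratio_def frac_le)
  have "iterate_ratio 1 < 1 / \<zeta>"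
    using z p_pos by (simp add: iterate_ratio_def divide_strict_right_mono)
  with le show "iterate_ratio (Suc n) < 1 / \<zeta>"
    by simp
qed

text \<open>All row sums in the iterates of the generator converge, and the iterates are geometric.\<close>
lemma generator_row_has_sum:
  assumes v: "\<And>j. j \<ge> 1 \<Longrightarrow> v j = c * iterate_ratio n ^ j" and "i \<ge> 1"
  shows "((\<lambda>j. G_matrix T i j * diag_apply (\<lambda>j. \<gamma> / \<zeta> ^ j) v j) has_sum
    (\<gamma> * t_hat T (iterate_ratio (Suc n)) * c * iterate_ratio (Suc n) ^ i)) {1..}"
proof -
  have scaled: "((\<lambda>j. (\<gamma> * c) * (G_matrix T i j * iterate_ratio (Suc n) ^ j)) has_sum
      (\<gamma> * c) * (t_hat T (iterate_ratio (Suc n)) * iterate_ratio (Suc n) ^ i)) {1..}"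
    by (rule has_sum_cmult_right, rule G_row_has_sum) (fact iterate_ratio_bounds assms)+
  have eq: "(\<gamma> * c) * (G_matrix T i j * iterate_ratio (Suc n) ^ j) =
      G_matrix T i j * diag_apply (\<lambda>j. \<gamma> / \<zeta> ^ j) v j" if "j \<in> {1..}" for j
  proof -
    have "iterate_ratio (Suc n) = iterate_ratio n / \<zeta>"
      by (simp add: iterate_ratio_def)
    then have "iterate_ratio (Suc n) ^ j = iterate_ratio n ^ j / \<zeta> ^ j"
      by (simp only: power_divide)
    moreover have "v j = c * iterate_ratio n ^ j"
      using that by (intro v) simp
    ultimately show ?thesis
      by (simp only: diag_apply_def) simp
  qed
  have "((\<lambda>j. G_matrix T i j * diag_apply (\<lambda>j. \<gamma> / \<zeta> ^ j) v j) has_sum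
      (\<gamma> * c) * (t_hat T (iterate_ratio (Suc n)) * iterate_ratio (Suc n) ^ i)) {1..}"
    by (rule has_sum_cong[THEN iffD1, OF _ scaled]) (rule eq)
  moreover have "(\<gamma> * c) * (t_hat T (iterate_ratio (Suc n)) * iterate_ratio (Suc n) ^ i) =
      \<gamma> * t_hat T (iterate_ratio (Suc n)) * c * iterate_ratio (Suc n) ^ i"
    by (simp only: mult_ac)
  ultimately show ?thesis
    by (simp only:)
qed

lemma generator_self_similar:
  "generator (self_similar_hbp T p \<gamma> \<zeta>) v =
    matrix_apply (G_matrix T) (diag_apply (\<lambda>j. \<gamma> / \<zeta> ^ j) v)"
  by (simp add: generator_def self_similar_hbp_def)

lemma generator_power:
  assumes "i \<ge> 1"
  shows "(generator (self_similar_hbp T p \<gamma> \<zeta>) ^^ n) (root_pmf (self_similar_hbp T p \<gamma> \<zeta>)) i =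
    iterate_coeff n * iterate_ratio n ^ i"
  using assms
proof (induction n arbitrary: i)
  case 0
  then show ?case
    using p_less by (cases i) (auto simp: self_similar_hbp_def iterate_ratio_def)
next
  case (Suc n)
  from infsumI[OF generator_row_has_sum[of _ "iterate_coeff n" n, OF Suc.IH Suc.prems]]
  have "generator (self_similar_hbp T p \<gamma> \<zeta>) ((generator (self_similar_hbp T p \<gamma> \<zeta>) ^^ n)
      (root_pmf (self_similar_hbp T p \<gamma> \<zeta>))) i =
      \<gamma> * t_hat T (iterate_ratio (Suc n)) * iterate_coeff n * iterate_ratio (Suc n) ^ i"
    by (subst generator_self_similar) (simp only: matrix_apply_def)
  then show ?case
    by (simp only: funpow.simps o_apply iterate_coeff.simps)
qed

lemma t_hat_bound:
  obtains M where "M > 0" "\<And>n. \<bar>t_hat T (iterate_ratio (Suc n))\<bar> \<le> M"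
proof
  define B where "B = (\<Sum>\<^sub>\<infinity>j\<in>{1..}. iterate_ratio 1 ^ j * T j)"
  have w1: "0 < iterate_ratio 1" "iterate_ratio 1 < 1 / \<zeta>"
    using iterate_ratio_bounds(1)[of 1] iterate_ratio_bounds(4)[of 0] by auto
  have B: "B \<ge> 0"
    unfolding B_def using T_nonneg w1 by (intro infsum_nonneg) auto
  show "0 < 3 + B"
    using B by simp
  fix n
  define w where "w = iterate_ratio (Suc n)"
  have w: "0 < w" "w < 1 / \<zeta>" "w \<le> iterate_ratio 1" "w \<le> 1"
    using iterate_ratio_bounds[of "Suc n"] iterate_ratio_bounds(3,4)[of n] p_pos by (auto simp: w_def)
  have "(\<Sum>\<^sub>\<infinity>j\<in>{1..}. w ^ j * T j) \<le> B"
    unfolding B_def using T_nonneg w w1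
    by (intro infsum_mono tokunaga_series_summable mult_right_mono power_mono) auto
  moreover have "(\<Sum>\<^sub>\<infinity>j\<in>{1..}. w ^ j * T j) \<ge> 0"
    using T_nonneg w by (intro infsum_nonneg) auto
  ultimately show "\<bar>t_hat T (iterate_ratio (Suc n))\<bar> \<le> 3 + B"
    using w unfolding t_hat_def w_def[symmetric] by linarith
qed

lemma iterate_coeff_bound:
  obtains M C where "M > 0" "C > 0" "\<And>n i. \<bar>iterate_coeff n * iterate_ratio n ^ i\<bar> \<le> C * M ^ n * (1 - p) ^ i"
    "\<And>n i. \<bar>iterate_coeff n * iterate_ratio (Suc n) ^ i\<bar> \<le> C * M ^ n * iterate_ratio 1 ^ i"
proof -
  obtain M where M: "M > 0" "\<And>n. \<bar>t_hat T (iterate_ratio (Suc n))\<bar> \<le> M"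
    by (rule t_hat_bound) (rule that)
  have b: "\<bar>iterate_coeff n\<bar> \<le> p / (1 - p) * (\<gamma> * M) ^ n" for n
  proof (induction n)
    case (Suc n)
    have "\<bar>iterate_coeff (Suc n)\<bar> = (\<gamma> * \<bar>t_hat T (iterate_ratio (Suc n))\<bar>) * \<bar>iterate_coeff n\<bar>"
      using gamma_pos by (simp add: abs_mult)
    also have "\<dots> \<le> (\<gamma> * M) * (p / (1 - p) * (\<gamma> * M) ^ n)"
      using Suc M gamma_pos by (intro mult_mono) auto
    finally show ?case
      by (simp add: mult_ac)
  qed (use p_pos p_less in auto)
  show ?thesis
  proof (rule that)
    show "\<gamma> * M > 0" "p / (1 - p) > 0"
      using M gamma_pos p_pos p_less by auto
    have nn: "p / (1 - p) * (\<gamma> * M) ^ n \<ge> 0" for n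
      using M gamma_pos p_pos p_less by auto
    show "\<bar>iterate_coeff n * iterate_ratio n ^ i\<bar> \<le> p / (1 - p) * (\<gamma> * M) ^ n * (1 - p) ^ i" for n i
      unfolding abs_mult
      by (intro mult_mono b nn) (use iterate_ratio_bounds[of n] in \<open>auto intro: power_mono\<close>)
    show "\<bar>iterate_coeff n * iterate_ratio (Suc n) ^ i\<bar> \<le> p / (1 - p) * (\<gamma> * M) ^ n * iterate_ratio 1 ^ i" for n i
      unfolding abs_mult
      by (intro mult_mono b nn)
        (use iterate_ratio_bounds(1)[of "Suc n"] iterate_ratio_bounds(3)[of n] in \<open>auto intro: power_mono\<close>)
  qed
qed

lemma mean_branches_summable:
  assumes "j \<ge> 1"
  shows "summable (\<lambda>n. \<bar>s ^ n / fact n * (generator (self_similar_hbp T p \<gamma> \<zeta>) ^^ n)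
    (root_pmf (self_similar_hbp T p \<gamma> \<zeta>)) j\<bar>)"
proof -
  obtain M C where M: "M > 0" "C > 0" "\<And>n i. \<bar>iterate_coeff n * iterate_ratio n ^ i\<bar> \<le> C * M ^ n * (1 - p) ^ i"
    by (rule iterate_coeff_bound) (rule that)
  have "summable (\<lambda>n. C * (1 - p) ^ j * (inverse (fact n) * (\<bar>s\<bar> * M) ^ n))"
    by (intro summable_mult summable_exp)
  then show ?thesis
  proof (rule summable_comparison_test')
    fix n
    have "\<bar>s ^ n / fact n * (iterate_coeff n * iterate_ratio n ^ j)\<bar> =
        \<bar>s\<bar> ^ n / fact n * \<bar>iterate_coeff n * iterate_ratio n ^ j\<bar>"
      by (simp add: abs_mult power_abs)
    also have "\<dots> \<le> \<bar>s\<bar> ^ n / fact n * (C * M ^ n * (1 - p) ^ j)"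
      by (intro mult_left_mono M) auto
    finally show "norm \<bar>s ^ n / fact n * (generator (self_similar_hbp T p \<gamma> \<zeta>) ^^ n)
        (root_pmf (self_similar_hbp T p \<gamma> \<zeta>)) j\<bar>
        \<le> C * (1 - p) ^ j * (inverse (fact n) * (\<bar>s\<bar> * M) ^ n)"
      by (simp add: generator_power[OF assms] power_mult_distrib field_simps)
  qed
qed

lemma width_summable:
  "(\<lambda>j. \<bar>mean_branches (self_similar_hbp T p \<gamma> \<zeta>) s j\<bar>) summable_on {1..}"
proof -
  obtain M C where M: "M > 0" "C > 0" "\<And>n i. \<bar>iterate_coeff n * iterate_ratio n ^ i\<bar> \<le> C * M ^ n * (1 - p) ^ i"
    by (rule iterate_coeff_bound) (rule that)
  have "(\<lambda>j. (1 - p) ^ j) summable_on UNIV"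
    using p_pos p_less by (intro norm_summable_imp_summable_on) (simp add: power_abs)
  then have "(\<lambda>j. (C * exp (\<bar>s\<bar> * M)) * (1 - p) ^ j) summable_on {1..}"
    by (intro summable_on_cmult_right) (rule summable_on_subset_banach, auto)
  then have "(\<lambda>j. norm (mean_branches (self_similar_hbp T p \<gamma> \<zeta>) s j)) summable_on {1..}"
  proof (rule Infinite_Sum.abs_summable_on_comparison_test')
    fix j :: nat assume "j \<in> {1..}"
    then have j: "j \<ge> 1" by simp
    let ?a = "\<lambda>n. s ^ n / fact n * (generator (self_similar_hbp T p \<gamma> \<zeta>) ^^ n)
      (root_pmf (self_similar_hbp T p \<gamma> \<zeta>)) j"
    have e: "(\<lambda>n. (C * (1 - p) ^ j) * (inverse (fact n) * (\<bar>s\<bar> * M) ^ n)) sums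
        ((C * (1 - p) ^ j) * exp (\<bar>s\<bar> * M))"
      using exp_converges[of "\<bar>s\<bar> * M"] by (intro sums_mult) (simp add: scaleR_conv_of_real)
    have "\<bar>?a n\<bar> \<le> (C * (1 - p) ^ j) * (inverse (fact n) * (\<bar>s\<bar> * M) ^ n)" for n
    proof -
      have "\<bar>?a n\<bar> = \<bar>s\<bar> ^ n / fact n * \<bar>iterate_coeff n * iterate_ratio n ^ j\<bar>"
        by (simp add: generator_power[OF j] abs_mult power_abs)
      also have "\<dots> \<le> \<bar>s\<bar> ^ n / fact n * (C * M ^ n * (1 - p) ^ j)"
        by (intro mult_left_mono M) auto
      finally show ?thesis
        by (simp add: power_mult_distrib field_simps)
    qed
    then have "(\<Sum>n. \<bar>?a n\<bar>) \<le> (C * (1 - p) ^ j) * exp (\<bar>s\<bar> * M)"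
      using suminf_le[OF _ mean_branches_summable[OF j, of s] sums_summable[OF e]] sums_unique[OF e]
      by simp
    moreover have "\<bar>\<Sum>n. ?a n\<bar> \<le> (\<Sum>n. \<bar>?a n\<bar>)"
      by (rule summable_rabs[OF mean_branches_summable[OF j]])
    ultimately show "norm (mean_branches (self_similar_hbp T p \<gamma> \<zeta>) s j)
        \<le> (C * exp (\<bar>s\<bar> * M)) * (1 - p) ^ j"
      by (simp add: mean_branches_def exp_apply_def mult_ac)
  qed
  then show ?thesis
    by simp
qed

lemma mean_branches_0:
  "mean_branches (self_similar_hbp T p \<gamma> \<zeta>) 0 = root_pmf (self_similar_hbp T p \<gamma> \<zeta>)"
proof
  fix j
  have "(\<lambda>n. (0::real) ^ n / fact n * (generator (self_similar_hbp T p \<gamma> \<zeta>) ^^ n)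
      (root_pmf (self_similar_hbp T p \<gamma> \<zeta>)) j) sums
      (\<Sum>n\<in>{0}. 0 ^ n / fact n * (generator (self_similar_hbp T p \<gamma> \<zeta>) ^^ n)
      (root_pmf (self_similar_hbp T p \<gamma> \<zeta>)) j)"
    by (rule sums_finite) auto
  then show "mean_branches (self_similar_hbp T p \<gamma> \<zeta>) 0 j = root_pmf (self_similar_hbp T p \<gamma> \<zeta>) j"
    by (simp add: mean_branches_def exp_apply_def sums_iff)
qed

text \<open>The expected numbers satisfy their evolution equation \<open>x' = \<G>\<Lambda>x\<close>.\<close>
lemma mean_branches_ode:
  assumes i: "i \<ge> 1"
  defines "S \<equiv> self_similar_hbp T p \<gamma> \<zeta>"
  shows "((\<lambda>s. mean_branches S s i) has_real_derivative generator S (mean_branches S s) i) (at s)"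
proof -
  define a where "a n j = (generator S ^^ n) (root_pmf S) j" for n j
  define h where "h j n = G_matrix T i j * (\<gamma> / \<zeta> ^ j) * (s ^ n / fact n * a n j)" for j n
  have a: "a n j = iterate_coeff n * iterate_ratio n ^ j" if "j \<ge> 1" for n j
    using generator_power[OF that] by (simp add: a_def S_def)
  have smb: "summable (\<lambda>n. \<bar>s ^ n / fact n * a n j\<bar>)" if "j \<ge> 1" for j s
    using mean_branches_summable[OF that, of s] by (simp add: a_def S_def)
  have mb: "mean_branches S s j = (\<Sum>n. s ^ n / fact n * a n j)" for s j
    by (simp add: mean_branches_def exp_apply_def a_def)
  have "((\<lambda>s. \<Sum>n. (a n i / fact n) * s ^ n) has_real_derivative
      (\<Sum>n. diffs (\<lambda>n. a n i / fact n) n * s ^ n)) (at s)"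
    by (rule termdiffs_strong_converges_everywhere)
       (use summable_rabs_cancel[OF smb[OF i]] in \<open>simp add: mult.commute\<close>)
  moreover have "diffs (\<lambda>n. a n i / fact n) n * s ^ n = s ^ n / fact n * a (Suc n) i" for n
    by (simp add: diffs_def mult.commute del: of_nat_Suc)
  ultimately have deriv: "((\<lambda>s. mean_branches S s i) has_real_derivative
      (\<Sum>n. s ^ n / fact n * a (Suc n) i)) (at s)"
    by (simp add: mb mult.commute)

  obtain M C where M: "M > 0" "C > 0"
    "\<And>n i. \<bar>iterate_coeff n * iterate_ratio (Suc n) ^ i\<bar> \<le> C * M ^ n * iterate_ratio 1 ^ i"
    by (rule iterate_coeff_bound) (rule that)
  define F where "F j = C * \<gamma> * \<bar>G_matrix T i j * iterate_ratio 1 ^ j\<bar>" for j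
  define H where "H n = inverse (fact n) * (\<bar>s\<bar> * M) ^ n" for n
  have H0: "H n \<ge> 0" for n
    using M by (simp add: H_def)
  have "summable H"
    unfolding H_def by (rule summable_exp)
  then have "H summable_on UNIV"
    using summable_on_UNIV_nonneg_real_iff[of H] H0 by blast
  note H = this H0
  have "(\<lambda>j. G_matrix T i j * iterate_ratio 1 ^ j) summable_on {1..}"
    using G_row_has_sum[OF _ _ i, of "iterate_ratio 1"] iterate_ratio_bounds(1)[of 1] iterate_ratio_bounds(4)[of 0]
    by (auto simp: summable_on_def)
  then have "(\<lambda>j. \<bar>G_matrix T i j * iterate_ratio 1 ^ j\<bar>) summable_on {1..}"
    using summable_on_iff_abs_summable_on_real[of "\<lambda>j. G_matrix T i j * iterate_ratio 1 ^ j" "{1..}"] by simp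
  then have F: "F summable_on {1..}"
    unfolding F_def by (rule summable_on_cmult_right)
  have F0: "F j \<ge> 0" for j
    using M gamma_pos by (simp add: F_def)
  have "(\<lambda>x. norm (case x of (j, n) \<Rightarrow> F j * H n)) summable_on ({1..} \<times> UNIV)"
    unfolding Infinite_Sum.abs_summable_on_Sigma_iff
    using F H F0
    by (auto simp: abs_mult infsum_cmult_right' intro!: summable_on_cmult_right summable_on_cmult_left)
  then have "(\<lambda>x. norm (case x of (j, n) \<Rightarrow> h j n)) summable_on ({1..} \<times> UNIV)"
  proof (rule Infinite_Sum.abs_summable_on_comparison_test)
    fix x :: "nat \<times> nat" assume "x \<in> {1..} \<times> UNIV"
    then obtain j n where x: "x = (j, n)" and j: "j \<ge> 1"
      by auto
    have "iterate_ratio n / \<zeta> = iterate_ratio (Suc n)"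
      by (simp add: iterate_ratio_def)
    then have w: "iterate_ratio n ^ j / \<zeta> ^ j = iterate_ratio (Suc n) ^ j"
      by (metis power_divide)
    have "h j n = G_matrix T i j * \<gamma> * (s ^ n / fact n) * (iterate_coeff n * iterate_ratio (Suc n) ^ j)"
      unfolding h_def a[OF j] w[symmetric] by (simp add: mult_ac)
    then have "\<bar>h j n\<bar> = \<bar>G_matrix T i j\<bar> * \<gamma> * (\<bar>s\<bar> ^ n / fact n) * \<bar>iterate_coeff n * iterate_ratio (Suc n) ^ j\<bar>"
      using gamma_pos by (simp add: abs_mult power_abs)
    also have "\<dots> \<le> \<bar>G_matrix T i j\<bar> * \<gamma> * (\<bar>s\<bar> ^ n / fact n) * (C * M ^ n * iterate_ratio 1 ^ j)"
      using gamma_pos by (intro mult_left_mono M) auto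
    also have "\<dots> = F j * H n"
      using iterate_ratio_bounds(1)[of 1]
      by (simp add: F_def H_def abs_mult power_mult_distrib field_simps)
    finally show "norm (case x of (j, n) \<Rightarrow> h j n) \<le> norm (case x of (j, n) \<Rightarrow> F j * H n)"
      using F0 H(2) by (simp add: x)
  qed
  then have abs_h: "(\<lambda>(j, n). h j n) summable_on ({1..} \<times> UNIV)"
    by (rule abs_summable_summable)
  then have swap: "(\<Sum>\<^sub>\<infinity>j\<in>{1..}. \<Sum>\<^sub>\<infinity>n. h j n) = (\<Sum>\<^sub>\<infinity>n. \<Sum>\<^sub>\<infinity>j\<in>{1..}. h j n)"
    by (rule infsum_swap_banach)
  have "(\<Sum>\<^sub>\<infinity>n. h j n) = G_matrix T i j * diag_apply (\<lambda>j. \<gamma> / \<zeta> ^ j) (mean_branches S s) j"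
    if "j \<in> {1..}" for j
  proof -
    have "(\<Sum>\<^sub>\<infinity>n. s ^ n / fact n * a n j) = mean_branches S s j"
    proof -
      have sm: "summable (\<lambda>n. norm (s ^ n / fact n * a n j))"
        using smb[of j s] that by simp
      from norm_summable_imp_has_sum[OF sm summable_sums[OF summable_norm_cancel[OF sm]]]
      show ?thesis
        unfolding mb by (rule infsumI)
    qed
    then show ?thesis
      unfolding h_def by (simp only: infsum_cmult_right' diag_apply_def mult.assoc)
  qed
  then have left: "(\<Sum>\<^sub>\<infinity>j\<in>{1..}. \<Sum>\<^sub>\<infinity>n. h j n) = generator S (mean_branches S s) i"
    unfolding S_def generator_self_similar matrix_apply_def by (rule infsum_cong)
  have right: "(\<Sum>\<^sub>\<infinity>j\<in>{1..}. h j n) = s ^ n / fact n * a (Suc n) i" for n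
  proof -
    have "((\<lambda>j. (s ^ n / fact n) * (G_matrix T i j * diag_apply (\<lambda>j. \<gamma> / \<zeta> ^ j) (a n) j)) has_sum
        (s ^ n / fact n) * (\<gamma> * t_hat T (iterate_ratio (Suc n)) * iterate_coeff n * iterate_ratio (Suc n) ^ i)) {1..}"
      by (intro has_sum_cmult_right generator_row_has_sum a i)
    from infsumI[OF this] show ?thesis
      unfolding h_def a[OF i] diag_apply_def by (simp add: mult_ac)
  qed
  have "(\<Sum>\<^sub>\<infinity>n. s ^ n / fact n * a (Suc n) i) = (\<Sum>n. s ^ n / fact n * a (Suc n) i)"
  proof -
    have "(\<lambda>(n, j). h j n) summable_on (UNIV \<times> {1..})"
      using abs_h summable_on_swap[of "\<lambda>(n, j). h j n" UNIV "{1..}"] by simp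
    then have "(\<lambda>n. \<Sum>\<^sub>\<infinity>j\<in>{1..}. h j n) summable_on UNIV"
      by (rule summable_on_Sigma_banach)
    then have "(\<lambda>n. s ^ n / fact n * a (Suc n) i) summable_on UNIV"
      by (simp only: right)
    from sums_unique[OF has_sum_imp_sums[OF has_sum_infsum[OF this]]] show ?thesis .
  qed
  moreover have "generator S (mean_branches S s) i = (\<Sum>\<^sub>\<infinity>n. s ^ n / fact n * a (Suc n) i)"
    using swap unfolding left right .
  ultimately show ?thesis
    using deriv by (simp only:)
qed

end

end

theory Submission
  imports Defs
begin

text \<open>
  The initial vector \<open>\<pi>\<close> is geometric, and the Toeplitz operator \<open>\<G>\<close> acts on a geometric sequence
  \<open>w\<^sup>j\<close> as multiplication by \<open>t_hat T w\<close>. The diagonal operator \<open>\<Lambda>\<close> replaces the ratio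
  \<open>w\<close> by \<open>w / \<zeta>\<close>. So \<open>(\<G>\<Lambda>)\<^sup>n \<pi>\<close> is again geometric, with ratio \<open>(1 - p) / \<zeta>\<^sup>n\<close>, and its
  coefficient contains the factors \<open>t_hat T ((1 - p) / \<zeta>\<^sup>m)\<close> for \<open>1 \<le> m \<le> n\<close>. All three
  conditions turn out to say that the first of these factors vanishes,
  \<open>t_hat T ((1 - p) / \<zeta>) = 0\<close>.

  If it vanishes, then \<open>\<G>\<Lambda>\<pi> = 0\<close>, the exponential series stops after its first term, and the
  process is time-invariant, hence critical because \<open>\<pi>\<close> has total mass \<open>1\<close>. In the other
  direction, summing the exponential series over all orders (lemma \<open>width_power_series\<close>) exhibits
  the width function as an everywhere convergent power series whose linear coefficient is a positive
  multiple of \<open>t_hat T ((1 - p) / \<zeta>)\<close>. A critical process has constant width on the half line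
  \<open>s \<ge> 0\<close>, and this already forces the linear coefficient to be zero.

  Finally, \<open>t_hat\<close> is strictly increasing at positive points of convergence, so it has at most one
  zero among them. The point \<open>(1 - p) / \<zeta>\<close> always lies inside the disc of convergence. Hence it is a
  zero if and only if it is the Horton root \<open>1 / R\<close>, and solving \<open>(1 - p) / \<zeta> = 1 / R\<close> for \<open>p\<close>
  gives the critical value; the condition \<open>\<zeta> < R\<close> expresses that this value is positive.
\<close>

section \<open>The Horton root\<close>

lemma tokunaga_growth_nonneg:
  assumes "\<And>k. k \<ge> 1 \<Longrightarrow> T k \<ge> 0"
  shows "tokunaga_growth T \<ge> 0"
proof -
  have "0 = limsup (\<lambda>n::nat. 0::ereal)"
    by (simp add: Limsup_const)
  also have "\<dots> \<le> tokunaga_growth T"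
    unfolding tokunaga_growth_def
    by (intro Limsup_mono eventually_sequentiallyI[of 1])
      (use assms in \<open>simp add: real_root_ge_zero\<close>)
  finally show ?thesis .
qed

lemma t_hat_strict_mono:
  assumes nonneg: "\<And>k. k \<ge> 1 \<Longrightarrow> T k \<ge> 0"
    and vw: "0 < v" "v < w"
    and summable: "(\<lambda>j. w ^ j * T j) summable_on {1..}"
  shows "t_hat T v < t_hat T w"
proof -
  have le: "v ^ j * T j \<le> w ^ j * T j" if "j \<in> {1..}" for j
    using that vw nonneg by (intro mult_right_mono power_mono) auto
  have "(\<lambda>j. v ^ j * T j) summable_on {1..}"
    using summable le by (rule summable_on_comparison_test) (use vw nonneg in auto)
  then have "(\<Sum>\<^sub>\<infinity>j\<in>{1..}. v ^ j * T j) \<le> (\<Sum>\<^sub>\<infinity>j\<in>{1..}. w ^ j * T j)"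
    using summable le by (rule infsum_mono)
  then show ?thesis
    using vw by (simp add: t_hat_def)
qed

lemma horton_root_unique:
  assumes nonneg: "\<And>k. k \<ge> 1 \<Longrightarrow> T k \<ge> 0"
    and growth: "tokunaga_growth T < \<infinity>"
    and v: "horton_root T v" and w: "horton_root T w"
  shows "v = w"
proof -
  have summable: "(\<lambda>j. u ^ j * T j) summable_on {1..}" if u: "horton_root T u" for u
  proof -
    have bounds: "0 < u" "u \<le> 1 / 2" "ereal u < 1 / tokunaga_growth T"
      using u by (auto simp: horton_root_def)
    have "max 1 (tokunaga_growth T) \<noteq> \<infinity>" "max 1 (tokunaga_growth T) \<noteq> - \<infinity>"
      using growth by (auto simp: max_def)
    then obtain z where z: "max 1 (tokunaga_growth T) = ereal z"
      by (metis ereal_cases)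
    \<comment> \<open>Convergence is known for \<open>u < 1 / z\<close> with any \<open>z \<ge> max 1 L\<close>. Equality is the best choice, and
      since \<open>u \<le> 1 / 2\<close> the bound \<open>z \<ge> 1\<close> excludes no candidate root.\<close>
    have "u < 1 / z"
    proof (cases "tokunaga_growth T \<le> 1")
      case True
      then have "z = 1"
        using z by (simp add: max_def one_ereal_def split: if_splits)
      then show ?thesis
        using bounds by simp
    next
      case False
      then have "tokunaga_growth T = ereal z" "z > 1"
        using z by (auto simp: max_def one_ereal_def split: if_splits)
      then show ?thesis
        using bounds(3) by (simp add: one_ereal_def)
    qed
    then show ?thesis
      using tokunaga_series_summable[of T "1 / 2" 1 z u] nonneg growth bounds(1) z by simp
  qed
  show ?thesis
    using t_hat_strict_mono[OF nonneg _ _ summable[OF v], of w]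
      t_hat_strict_mono[OF nonneg _ _ summable[OF w], of v] v w
    by (cases v w rule: linorder_cases) (auto simp: horton_root_def)
qed

text \<open>
  A zero of \<open>t_hat\<close> cannot exceed \<open>1 / 2\<close>, because the terms with \<open>T\<close> are nonnegative. Together
  with \<open>w < 1 / \<zeta> \<le> 1 / L\<close> this puts every such zero in the domain that defines the Horton root.
\<close>
lemma t_hat_zero_iff_horton_exponent:
  assumes nonneg: "\<And>k. k \<ge> 1 \<Longrightarrow> T k \<ge> 0"
    and growth: "tokunaga_growth T < \<infinity>"
    and zeta: "ereal \<zeta> \<ge> max 1 (tokunaga_growth T)"
    and w: "0 < w" "w < 1 / \<zeta>"
  shows "t_hat T w = 0 \<longleftrightarrow> \<zeta> < horton_exponent T \<and> w = 1 / horton_exponent T"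
proof
  have z1: "\<zeta> \<ge> 1"
    using zeta by simp
  assume root: "t_hat T w = 0"
  have "(\<Sum>\<^sub>\<infinity>j\<in>{1..}. w ^ j * T j) \<ge> 0"
    using nonneg w by (intro infsum_nonneg) auto
  then have half: "w \<le> 1 / 2"
    using root by (simp add: t_hat_def)
  have "ereal w < 1 / tokunaga_growth T"
  proof (cases "tokunaga_growth T = 0")
    case True
    then show ?thesis
      by (simp add: divide_ereal_def)
  next
    case False
    then obtain l where l: "tokunaga_growth T = ereal l" "l > 0"
      using tokunaga_growth_nonneg[of T, OF nonneg] growth
      by (cases "tokunaga_growth T") auto
    then have "1 / \<zeta> \<le> 1 / l"
      using zeta by (intro divide_left_mono) auto
    then show ?thesis
      using w l by (simp add: one_ereal_def)
  qed
  then have hr: "horton_root T w"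
    using w half root by (simp add: horton_root_def)
  then have ex1: "\<exists>!w. horton_root T w"
    using horton_root_unique[OF nonneg growth] by blast
  then have "(THE w. horton_root T w) = w"
    using hr by (rule the1_equality)
  then have "horton_exponent T = 1 / w"
    using ex1 by (simp add: horton_exponent_def inverse_eq_divide)
  moreover have "\<zeta> < 1 / w"
    using w z1 by (simp add: field_simps)
  ultimately show "\<zeta> < horton_exponent T \<and> w = 1 / horton_exponent T"
    by simp
next
  assume *: "\<zeta> < horton_exponent T \<and> w = 1 / horton_exponent T"
  moreover have "\<zeta> \<ge> 1"
    using zeta by simp
  \<comment> \<open>Without a root the exponent has the default value \<open>0\<close>, which cannot exceed \<open>\<zeta> \<ge> 1\<close>.\<close>
  ultimately have ex1: "\<exists>!w. horton_root T w"
    by (auto simp: horton_exponent_def split: if_splits)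
  then have "w = (THE w. horton_root T w)"
    using * by (simp add: horton_exponent_def inverse_eq_divide)
  then have "horton_root T w"
    using theI'[OF ex1] by simp
  then show "t_hat T w = 0"
    by (simp add: horton_root_def)
qed

section \<open>The width function as a power series\<close>

text \<open>
  Constancy on the half line suffices, since the linear coefficient is the one-sided
  derivative at \<open>0\<close>.
\<close>
lemma power_series_linear_coeff_zero:
  fixes a :: "nat \<Rightarrow> real"
  assumes sums: "\<And>s. (\<lambda>n. a n * s ^ n) sums f s"
    and const: "\<And>s. s \<ge> 0 \<Longrightarrow> f s = c"
  shows "a 1 = 0"
proof -
  have f: "f = (\<lambda>s. \<Sum>n. a n * s ^ n)"
    using sums_unique[OF sums] by auto
  have "(f has_real_derivative (\<Sum>n. diffs a n * 0 ^ n)) (at 0)"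
    unfolding f using sums_summable[OF sums] by (rule termdiffs_strong_converges_everywhere)
  then have "(f has_real_derivative a 1) (at 0 within {0..})"
    by (auto simp: diffs_def intro: has_field_derivative_at_within)
  moreover have "(f has_real_derivative 0) (at 0 within {0..})"
    by (rule has_field_derivative_transform_within[of "\<lambda>_. c" _ _ _ 1]) (use const in auto)
  ultimately show ?thesis
    by (rule has_field_derivative_unique) (simp add: at_within_Ici_at_right)
qed

context
  fixes T :: "nat \<Rightarrow> real" and p \<gamma> \<zeta> :: real
  assumes T_nonneg: "\<And>k. k \<ge> 1 \<Longrightarrow> T k \<ge> 0"
    and p_pos: "0 < p" and p_less: "p < 1" and gamma_pos: "\<gamma> > 0"
    and growth: "tokunaga_growth T < \<infinity>"
    and zeta: "ereal \<zeta> \<ge> max 1 (tokunaga_growth T)"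
begin

lemmas hyps = T_nonneg p_pos p_less gamma_pos growth zeta

abbreviation (input) process :: hbp where
  "process \<equiv> self_similar_hbp T p \<gamma> \<zeta>"

abbreviation (input) coeff :: "nat \<Rightarrow> real" where
  "coeff \<equiv> iterate_coeff T p \<gamma> \<zeta>"

abbreviation (input) ratio :: "nat \<Rightarrow> real" where
  "ratio \<equiv> iterate_ratio p \<zeta>"

lemma mean_branches_has_sum:
  assumes "j \<ge> 1"
  shows "((\<lambda>n. s ^ n / fact n * (coeff n * ratio n ^ j)) has_sum mean_branches process s j) UNIV"
proof -
  have "summable (\<lambda>n. norm (s ^ n / fact n * (coeff n * ratio n ^ j)))"
    using mean_branches_summable[OF hyps assms, of s] by (simp add: generator_power[OF hyps assms])
  from norm_summable_imp_has_sum[OF this summable_sums[OF summable_norm_cancel[OF this]]]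
  show ?thesis
    by (simp add: mean_branches_def exp_apply_def generator_power[OF hyps assms])
qed

text \<open>
  The width sums the exponential series first over \<open>n\<close> and then over \<open>j\<close>. The double family is
  dominated by the product of an exponential series in \<open>n\<close> and the geometric series
  \<open>(1 - p)\<^sup>j\<close>, so the order of summation may be exchanged; the inner sums over \<open>j\<close> are then
  geometric.
\<close>
lemma width_power_series:
  "(\<lambda>n. coeff n / fact n * (ratio n / (1 - ratio n)) * s ^ n) sums width process s"
proof -
  define h where "h = (\<lambda>(j, n). s ^ n / fact n * (coeff n * ratio n ^ j))"
  obtain M C where M: "M > 0" "C > 0" "\<And>n i. \<bar>coeff n * ratio n ^ i\<bar> \<le> C * M ^ n * (1 - p) ^ i"
    by (rule iterate_coeff_bound[OF hyps], assumption, rule that)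
  define H where "H n = inverse (fact n) * (\<bar>s\<bar> * M) ^ n" for n
  define F where "F j = C * (1 - p) ^ j" for j :: nat
  have H0: "H n \<ge> 0" for n
    using M by (simp add: H_def)
  have "summable H"
    unfolding H_def by (rule summable_exp)
  then have H: "H summable_on UNIV"
    using summable_on_UNIV_nonneg_real_iff[of H] H0 by blast
  have "((\<lambda>j. (1 - p) ^ j) has_sum ((1 - p) / (1 - (1 - p)))) {1..}"
    by (rule has_sum_geometric_from_1) (use p_pos p_less in simp)
  then have F: "F summable_on {1..}"
    unfolding F_def by (intro summable_on_cmult_right has_sum_imp_summable)
  have F0: "F j \<ge> 0" for j
    using M p_less by (simp add: F_def)
  have "(\<lambda>x. norm (case x of (j, n) \<Rightarrow> F j * H n)) summable_on ({1..} \<times> UNIV)"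
    unfolding Infinite_Sum.abs_summable_on_Sigma_iff
    using F H F0 H0
    by (auto simp: abs_mult infsum_cmult_right' intro!: summable_on_cmult_right summable_on_cmult_left)
  then have "(\<lambda>x. norm (h x)) summable_on ({1..} \<times> UNIV)"
  proof (rule Infinite_Sum.abs_summable_on_comparison_test)
    fix x :: "nat \<times> nat"
    obtain j n where x: "x = (j, n)"
      by fastforce
    have "\<bar>h (j, n)\<bar> = \<bar>s\<bar> ^ n / fact n * \<bar>coeff n * ratio n ^ j\<bar>"
      by (simp add: h_def abs_mult power_abs)
    also have "\<dots> \<le> \<bar>s\<bar> ^ n / fact n * (C * M ^ n * (1 - p) ^ j)"
      by (intro mult_left_mono M) auto
    also have "\<dots> = F j * H n"
      by (simp add: F_def H_def power_mult_distrib field_simps)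
    finally show "norm (h x) \<le> norm (case x of (j, n) \<Rightarrow> F j * H n)"
      using F0 H0 by (simp add: x)
  qed
  then have "h summable_on ({1..} \<times> UNIV)"
    by (rule abs_summable_summable)
  then obtain W where W: "(h has_sum W) ({1..} \<times> UNIV)"
    by (auto simp: summable_on_def)
  have "(mean_branches process s has_sum W) {1..}"
    by (rule has_sum_SigmaD[OF W]) (use mean_branches_has_sum in \<open>simp add: h_def\<close>)
  then have width: "width process s = W"
    unfolding width_def by (rule infsumI)
  have "((\<lambda>(n, j). h (j, n)) has_sum W) (UNIV \<times> {1..})"
    using W has_sum_swap[of h "{1..}" UNIV W] by simp
  then have "((\<lambda>n. coeff n / fact n * (ratio n / (1 - ratio n)) * s ^ n) has_sum W) UNIV"
  proof (rule has_sum_SigmaD)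
    fix n
    have "((\<lambda>j. ratio n ^ j) has_sum (ratio n / (1 - ratio n))) {1..}"
      by (rule has_sum_geometric_from_1)
        (use iterate_ratio_bounds(1,2)[OF hyps, of n] p_pos in simp)
    from has_sum_cmult_right[OF this, of "s ^ n / fact n * coeff n"]
    show "((\<lambda>j. case (n, j) of (n, j) \<Rightarrow> h (j, n)) has_sum
        coeff n / fact n * (ratio n / (1 - ratio n)) * s ^ n) {1..}"
      by (simp add: h_def mult_ac)
  qed
  then show ?thesis
    unfolding width by (rule has_sum_imp_sums)
qed

section \<open>Criticality and time invariance\<close>

lemma critical_imp_t_hat_zero:
  assumes "critical process"
  shows "t_hat T ((1 - p) / \<zeta>) = 0"
proof -
  have "coeff 1 / fact 1 * (ratio 1 / (1 - ratio 1)) = 0"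
    by (rule power_series_linear_coeff_zero[OF width_power_series])
      (use assms in \<open>simp add: critical_def\<close>)
  moreover have "ratio 1 > 0" "ratio 1 < 1"
    using iterate_ratio_bounds(1,2)[OF hyps, of 1] p_pos by auto
  ultimately have "coeff 1 = 0"
    by simp
  then show ?thesis
    using gamma_pos p_pos p_less
    by (simp add: iterate_coeff.simps[OF hyps] iterate_ratio_def[OF hyps])
qed

text \<open>
  Every coefficient after the first inherits the factor \<open>t_hat T ((1 - p) / \<zeta>)\<close>, so only the
  term \<open>n = 0\<close> of the exponential series survives.
\<close>
lemma t_hat_zero_imp_time_invariant:
  assumes "t_hat T ((1 - p) / \<zeta>) = 0"
  shows "time_invariant process"
  unfolding time_invariant_def
proof (intro allI impI)
  fix s :: real and j :: nat
  assume j: "j \<ge> 1"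
  have c0: "coeff (Suc n) = 0" for n
  proof (induction n)
    case 0
    show ?case
      using assms by (simp add: iterate_coeff.simps[OF hyps] iterate_ratio_def[OF hyps])
  next
    case (Suc n)
    show ?case
      by (subst iterate_coeff.simps(2)[OF hyps]) (simp_all only: Suc.IH mult_zero_right)
  qed
  have "((\<lambda>n. s ^ n / fact n * (coeff n * ratio n ^ j)) has_sum
      (\<Sum>n\<in>{0}. s ^ n / fact n * (coeff n * ratio n ^ j))) UNIV"
    by (rule has_sum_finite_neutralI[where B = "{0}"]) (use c0 in \<open>auto simp: gr0_conv_Suc\<close>)
  with mean_branches_has_sum[OF j, of s]
  have "mean_branches process s j = coeff 0 * ratio 0 ^ j"
    using has_sum_unique by fastforce
  then show "mean_branches process s j = root_pmf process j"
    using generator_power[OF hyps j, of 0] by simp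
qed

lemma time_invariant_imp_critical:
  assumes "time_invariant process"
  shows "critical process"
  unfolding critical_def
proof (intro allI impI)
  fix s :: real
  assume "s \<ge> 0"
  then have "width process s = (\<Sum>\<^sub>\<infinity>j\<in>{1..}. root_pmf process j)"
    unfolding width_def using assms by (intro infsum_cong) (simp add: time_invariant_def)
  also have "\<dots> = 1"
    using hierarchical_branching_process_self_similar[OF hyps]
    by (simp add: hierarchical_branching_process_def infsumI)
  finally show "width process s = 1" .
qed

end

theorem theorem7:
  fixes T :: "nat \<Rightarrow> real" and p \<gamma> \<zeta> :: real
  assumes "\<And>k. k \<ge> 1 \<Longrightarrow> T k \<ge> 0"
    and "0 < p" and "p < 1" and "\<gamma> > 0"
    and "tokunaga_growth T < \<infinity>"
    and "ereal \<zeta> \<ge> max 1 (tokunaga_growth T)"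
  shows "(critical (self_similar_hbp T p \<gamma> \<zeta>) \<longleftrightarrow> time_invariant (self_similar_hbp T p \<gamma> \<zeta>)) \<and>
         (time_invariant (self_similar_hbp T p \<gamma> \<zeta>) \<longleftrightarrow>
            \<zeta> < horton_exponent T \<and> p = 1 - \<zeta> / horton_exponent T)"
proof -
  have z1: "\<zeta> \<ge> 1"
    using assms(6) by simp
  have w: "0 < (1 - p) / \<zeta>" "(1 - p) / \<zeta> < 1 / \<zeta>"
    using assms(2,3) z1 by (auto simp: divide_strict_right_mono)
  have "t_hat T ((1 - p) / \<zeta>) = 0 \<longleftrightarrow>
      \<zeta> < horton_exponent T \<and> (1 - p) / \<zeta> = 1 / horton_exponent T"
    by (rule t_hat_zero_iff_horton_exponent[OF assms(1,5,6) w])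
  also have "\<dots> \<longleftrightarrow> \<zeta> < horton_exponent T \<and> p = 1 - \<zeta> / horton_exponent T"
    using z1 by (auto simp: field_simps)
  finally show ?thesis
    using critical_imp_t_hat_zero[OF assms] t_hat_zero_imp_time_invariant[OF assms]
      time_invariant_imp_critical[OF assms]
    by blast
qed

end
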